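(* For a finite simple chordal outerplanar graph $G$ with maximum degree $\Delta \in \{2,3\}$, we have $\omega(G^2) = \chi(G^2) = \mathrm{ind}(G^2) + 1 = \Delta + 1$.
   Context: $G^2$ is the graph on $V(G)$ in which two distinct vertices are adjacent iff their distance in $G$ is 1 or 2; $\omega$ is the clique number, $\chi$ the chromatic number, and $\mathrm{ind}(H) = \max\{\delta(H') : H' \text{ an induced subgraph of } H\}$ the inductiveness, $\delta$ denoting minimum degree. *)

theory Defs
  imports "HOL-Analysis.Analysis" "HOL-Library.Extended_Nat"
begin

text \<open>A graph is given by a vertex set and a set of edges, each edge being an unordered pair
  of distinct vertices.\<close>

definition simple_graph :: "'a set \<Rightarrow> 'a set set \<Rightarrow> bool" where
  "simple_graph V E \<longleftrightarrow> (\<forall>e\<in>E. e \<subseteq> V \<and> card e = 2)"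

definition vdegree :: "'a set set \<Rightarrow> 'a \<Rightarrow> nat" where
  "vdegree E v = card {u. {v, u} \<in> E}"

text \<open>For finite nonempty \<open>V\<close> the supremum is the maximum; the graph without vertices gets
  maximum degree \<open>0\<close>.\<close>

definition max_degree :: "'a set \<Rightarrow> 'a set set \<Rightarrow> nat" where
  "max_degree V E = (SUP v\<in>V. vdegree E v)"

definition min_degree :: "'a set \<Rightarrow> 'a set set \<Rightarrow> nat" where
  "min_degree V E = Min (vdegree E ` V)"

definition induced_edges :: "'a set set \<Rightarrow> 'a set \<Rightarrow> 'a set set" where
  "induced_edges E W = {e \<in> E. e \<subseteq> W}"

definition inductiveness :: "'a set \<Rightarrow> 'a set set \<Rightarrow> nat" where
  "inductiveness V E = Max {min_degree W (induced_edges E W) | W. W \<subseteq> V \<and> W \<noteq> {}}"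

definition is_clique :: "'a set \<Rightarrow> 'a set set \<Rightarrow> 'a set \<Rightarrow> bool" where
  "is_clique V E K \<longleftrightarrow> K \<subseteq> V \<and> (\<forall>u\<in>K. \<forall>v\<in>K. u \<noteq> v \<longrightarrow> {u, v} \<in> E)"

definition clique_number :: "'a set \<Rightarrow> 'a set set \<Rightarrow> nat" where
  "clique_number V E = Max {card K | K. is_clique V E K}"

definition proper_coloring :: "'a set \<Rightarrow> 'a set set \<Rightarrow> nat \<Rightarrow> ('a \<Rightarrow> nat) \<Rightarrow> bool" where
  "proper_coloring V E k c \<longleftrightarrow>
     c ` V \<subseteq> {..<k} \<and> (\<forall>u\<in>V. \<forall>v\<in>V. {u, v} \<in> E \<longrightarrow> c u \<noteq> c v)"

definition chromatic_number :: "'a set \<Rightarrow> 'a set set \<Rightarrow> nat" where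
  "chromatic_number V E = (LEAST k. \<exists>c. proper_coloring V E k c)"

text \<open>A path is the list of its vertices; its length as a path is the number of its edges.\<close>

definition is_path :: "'a set \<Rightarrow> 'a set set \<Rightarrow> 'a list \<Rightarrow> bool" where
  "is_path V E p \<longleftrightarrow> p \<noteq> [] \<and> distinct p \<and> set p \<subseteq> V \<and>
     (\<forall>i. Suc i < length p \<longrightarrow> {p ! i, p ! Suc i} \<in> E)"

definition graph_dist :: "'a set \<Rightarrow> 'a set set \<Rightarrow> 'a \<Rightarrow> 'a \<Rightarrow> enat" where
  "graph_dist V E u v =
     (INF p\<in>{p. is_path V E p \<and> hd p = u \<and> last p = v}. enat (length p - 1))"

definition square_edges :: "'a set \<Rightarrow> 'a set set \<Rightarrow> 'a set set" where
  "square_edges V E =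
     {{u, v} | u v. u \<in> V \<and> v \<in> V \<and> u \<noteq> v \<and> graph_dist V E u v \<in> {1, 2}}"

definition cycle_edges :: "'a list \<Rightarrow> 'a set set" where
  "cycle_edges c = {{c ! i, c ! (Suc i mod length c)} | i. i < length c}"

definition is_cycle :: "'a set set \<Rightarrow> 'a list \<Rightarrow> bool" where
  "is_cycle E c \<longleftrightarrow> 3 \<le> length c \<and> distinct c \<and> cycle_edges c \<subseteq> E"

definition chordal :: "'a set set \<Rightarrow> bool" where
  "chordal E \<longleftrightarrow>
     (\<forall>c. is_cycle E c \<and> 4 \<le> length c \<longrightarrow> (\<exists>e\<in>E. e \<subseteq> set c \<and> e \<notin> cycle_edges c))"

text \<open>Plane embedding: vertices are distinct points, each edge is an arc joining its endpoints
  and meeting no further vertex, and two distinct edges meet only in common endpoints.\<close>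

definition plane_embedding ::
    "'a set \<Rightarrow> 'a set set \<Rightarrow> ('a \<Rightarrow> complex) \<Rightarrow> ('a set \<Rightarrow> real \<Rightarrow> complex) \<Rightarrow> bool" where
  "plane_embedding V E p \<gamma> \<longleftrightarrow>
     inj_on p V \<and>
     (\<forall>e\<in>E. arc (\<gamma> e) \<and> {pathstart (\<gamma> e), pathfinish (\<gamma> e)} = p ` e \<and>
             path_image (\<gamma> e) \<inter> p ` V = p ` e) \<and>
     (\<forall>e\<in>E. \<forall>f\<in>E. e \<noteq> f \<longrightarrow> path_image (\<gamma> e) \<inter> path_image (\<gamma> f) = p ` (e \<inter> f))"

definition drawing ::
    "'a set \<Rightarrow> 'a set set \<Rightarrow> ('a \<Rightarrow> complex) \<Rightarrow> ('a set \<Rightarrow> real \<Rightarrow> complex) \<Rightarrow> complex set" where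
  "drawing V E p \<gamma> = p ` V \<union> (\<Union>e\<in>E. path_image (\<gamma> e))"

text \<open>The drawing of a finite graph is compact, so \<open>outside\<close> of it is its unbounded face.\<close>

definition outerplanar :: "'a set \<Rightarrow> 'a set set \<Rightarrow> bool" where
  "outerplanar V E \<longleftrightarrow>
     (\<exists>p \<gamma>. plane_embedding V E p \<gamma> \<and> p ` V \<subseteq> frontier (outside (drawing V E p \<gamma>)))"

end

theory Submission
  imports Defs
begin

text \<open>
  The closed neighbourhood of a vertex of degree \<open>\<Delta>\<close> is a clique of \<open>G\<^sup>2\<close>, and
  \<open>\<omega> \<le> \<chi> \<le> ind + 1\<close> holds in every graph, so it suffices that every nonempty \<open>W\<close> contains
  a vertex of degree at most \<open>\<Delta>\<close> in \<open>G\<^sup>2[W]\<close>. Root a component of \<open>G\<close> at a vertex of \<open>W\<close> and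
  let \<open>v \<in> W\<close> have maximal depth \<open>k + 1\<close> in it. The vertices of depth \<open>k\<close> that are adjacent to the
  component of \<open>v\<close> in the layers beyond \<open>k\<close> form a clique \<open>Q\<close>, because \<open>G\<close> is chordal. Every vertex
  of depth at most \<open>k + 1\<close> that has distance at most \<open>2\<close> from \<open>v\<close> lies in \<open>Q\<close> or has a neighbour
  in \<open>Q\<close>. As \<open>\<Delta> \<le> 3\<close>, a vertex of \<open>Q\<close> has only one neighbour beyond layer \<open>k\<close> and one before it as
  soon as \<open>Q\<close> has a second vertex, and chordality then gives all vertices of \<open>Q\<close> the same closed
  neighbourhood, which contains \<open>v\<close>.
\<close>

section \<open>Walks and distances\<close>

definition neighbours :: "'a set set \<Rightarrow> 'a \<Rightarrow> 'a set" where
  "neighbours E v = {u. {v, u} \<in> E}"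

lemma mem_neighbours_iff: "u \<in> neighbours E v \<longleftrightarrow> {u, v} \<in> E"
  by (simp add: neighbours_def insert_commute)

lemma vdegree_eq_card_neighbours: "vdegree E v = card (neighbours E v)"
  by (simp add: vdegree_def neighbours_def)

lemma simple_graph_edgeD:
  assumes "simple_graph V E" "{u, v} \<in> E"
  shows "u \<in> V" "v \<in> V" "u \<noteq> v"
  using assms by (auto simp: simple_graph_def)

lemma neighbours_subset:
  assumes "simple_graph V E"
  shows "neighbours E v \<subseteq> V"
  using simple_graph_edgeD(1)[OF assms] by (auto simp: mem_neighbours_iff)

lemma finite_neighbours: "finite V \<Longrightarrow> simple_graph V E \<Longrightarrow> finite (neighbours E v)"
  using neighbours_subset finite_subset by metis

lemma card_closed_neighbourhood:
  assumes "finite V" "simple_graph V E"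
  shows "card (insert v (neighbours E v)) = Suc (vdegree E v)"
  using finite_neighbours[OF assms] simple_graph_edgeD(3)[OF assms(2), of v v]
  by (auto simp: vdegree_eq_card_neighbours mem_neighbours_iff card_insert_if)

lemma vdegree_le_max_degree:
  assumes "finite V" "simple_graph V E"
  shows "vdegree E v \<le> max_degree V E"
proof (cases "v \<in> V")
  case True
  then show ?thesis
    using assms(1) unfolding max_degree_def by (intro cSUP_upper) auto
next
  case False
  then have "neighbours E v = {}"
    using simple_graph_edgeD[OF assms(2)] by (auto simp: neighbours_def)
  then show ?thesis by (simp add: vdegree_eq_card_neighbours)
qed

lemma ex_vdegree_eq_max_degree:
  assumes "finite V" "V \<noteq> {}"
  obtains v where "v \<in> V" "vdegree E v = max_degree V E"
proof -
  have "max_degree V E \<in> vdegree E ` V"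
    using assms unfolding max_degree_def by (simp add: cSup_eq_Max)
  then show thesis using that by auto
qed

primrec path_edges :: "'a list \<Rightarrow> 'a set set" where
  "path_edges [] = {}"
| "path_edges (x # p) = (if p = [] then {} else insert {x, hd p} (path_edges p))"

lemma path_edges_append:
  "path_edges (p @ q) =
     path_edges p \<union> path_edges q \<union> (if p = [] \<or> q = [] then {} else {{last p, hd q}})"
  by (induction p) (simp_all add: insert_commute)

lemma path_edges_rev: "path_edges (rev p) = path_edges p"
  by (induction p) (simp_all add: path_edges_append last_rev insert_commute)

lemma path_edges_subset_Pow: "path_edges p \<subseteq> Pow (set p)"
  by (induction p) auto

lemma path_edges_conv_nth: "path_edges p = (\<lambda>i. {p ! i, p ! Suc i}) ` {..<length p - 1}"
proof (induction p)
  case (Cons x p)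
  then show ?case
    by (cases p) (simp_all add: lessThan_Suc_eq_insert_0 image_image del: lessThan_Suc)
qed simp

lemma cycle_edges_eq_path_edges:
  assumes "c \<noteq> []"
  shows "cycle_edges c = path_edges (c @ [hd c])"
proof -
  have "(c @ [hd c]) ! Suc i = c ! (Suc i mod length c)" if "i < length c" for i
    using that assms by (cases "Suc i = length c") (auto simp: nth_append hd_conv_nth)
  then show ?thesis
    by (auto simp: cycle_edges_def path_edges_conv_nth nth_append)
qed

definition walk :: "'a set set \<Rightarrow> 'a set \<Rightarrow> 'a \<Rightarrow> 'a list \<Rightarrow> 'a \<Rightarrow> bool" where
  "walk E S x p y \<longleftrightarrow> p \<noteq> [] \<and> hd p = x \<and> last p = y \<and> set p \<subseteq> S \<and> path_edges p \<subseteq> E"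

definition induced_path :: "'a set set \<Rightarrow> 'a list \<Rightarrow> bool" where
  "induced_path E p \<longleftrightarrow> distinct p \<and> induced_edges E (set p) = path_edges p"

lemma induced_path_distinct: "induced_path E p \<Longrightarrow> distinct p"
  by (simp add: induced_path_def)

lemma induced_pathD: "induced_path E p \<Longrightarrow> e \<in> E \<Longrightarrow> e \<subseteq> set p \<Longrightarrow> e \<in> path_edges p"
  unfolding induced_path_def induced_edges_def by blast

lemma is_path_iff_walk: "is_path V E p \<longleftrightarrow> walk E V (hd p) p (last p) \<and> distinct p"
  by (auto simp: is_path_def walk_def path_edges_conv_nth)

lemma walk_split:
  "walk E S x (us @ a # ws) y \<longleftrightarrow> walk E S x (us @ [a]) a \<and> walk E S a (a # ws) y"
proof -
  have "path_edges (us @ a # ws) = path_edges (us @ [a]) \<union> path_edges (a # ws)"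
    by (simp add: path_edges_append Un_ac)
  moreover have "hd (us @ a # ws) = hd (us @ [a])"
    by (cases us) simp_all
  ultimately show ?thesis
    unfolding walk_def by simp blast
qed

lemma pair_splits_list:
  assumes "a \<in> set p" "b \<in> set p" "a \<noteq> b"
  obtains us c ms d ws where "p = us @ c # ms @ d # ws" "{a, b} = {c, d}"
proof -
  obtain us ws where p: "p = us @ a # ws"
    using assms(1) split_list by metis
  with assms consider "b \<in> set us" | "b \<in> set ws" by auto
  then show thesis
  proof cases
    case 1
    then obtain us' ms where "us = us' @ b # ms"
      using split_list by metis
    then show thesis
      using that[of us' b ms a ws] p by (simp add: insert_commute)
  next
    case 2
    then obtain ms ws' where "ws = ms @ b # ws'"
      using split_list by metis
    then show thesis
      using that[of us a ms b ws'] p by simp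
  qed
qed

lemma walk_shortcut:
  assumes "simple_graph V E" "walk E S x p y" "\<not> induced_path E p"
  obtains q where "walk E S x q y" "length q < length p"
proof (cases "distinct p")
  case False
  then obtain us a ms ws where p: "p = us @ a # ms @ a # ws"
    using not_distinct_decomp by fastforce
  then have "walk E S x (us @ [a]) a" "walk E S a (a # ws) y"
    using assms(2) walk_split[of E S x us a "ms @ a # ws" y]
      walk_split[of E S x "us @ a # ms" a ws y] by simp_all
  then have "walk E S x (us @ a # ws) y"
    using walk_split by metis
  then show thesis
    using that p by simp
next
  case True
  have "path_edges p \<subseteq> induced_edges E (set p)"
    using assms(2) path_edges_subset_Pow[of p] unfolding walk_def induced_edges_def by blast
  then obtain e where e: "e \<in> E" "e \<subseteq> set p" "e \<notin> path_edges p"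
    using True assms(3) unfolding induced_path_def induced_edges_def by blast
  moreover from this obtain c d where "e = {c, d}" "c \<noteq> d"
    using assms(1) by (metis simple_graph_def card_2_iff)
  ultimately obtain us a ms b ws where p: "p = us @ a # ms @ b # ws" "e = {a, b}"
    using pair_splits_list[of c p d] by (metis insert_subset)
  have "ms \<noteq> []"
    using e(3) p by (auto simp: path_edges_append)
  have "walk E S x (us @ [a]) a" "walk E S b (b # ws) y"
    using assms(2) p(1) walk_split[of E S x us a "ms @ b # ws" y]
      walk_split[of E S x "us @ a # ms" b ws y] by simp_all
  then have "walk E S x (us @ a # b # ws) y"
    using e(1) p(2) by (subst walk_split) (simp add: walk_def)
  then show thesis
    using that p(1) \<open>ms \<noteq> []\<close> by simp
qed

lemma walk_imp_induced_path:
  assumes "simple_graph V E" "walk E S x p y"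
  obtains q where "walk E S x q y" "induced_path E q" "length q \<le> length p"
proof -
  obtain q where q: "walk E S x q y" and least: "\<And>q'. walk E S x q' y \<Longrightarrow> length q \<le> length q'"
    using ex_has_least_nat[of "\<lambda>q. walk E S x q y" p length] assms(2) by blast
  have "induced_path E q"
    using walk_shortcut[OF assms(1) q] least by (metis not_less)
  then show thesis
    using that q least assms(2) by blast
qed

lemma graph_dist_le_walk:
  assumes "simple_graph V E" "walk E V u p v"
  shows "graph_dist V E u v \<le> enat (length p - 1)"
proof -
  obtain q where q: "walk E V u q v" "induced_path E q" "length q \<le> length p"
    using walk_imp_induced_path[OF assms] .
  then have "is_path V E q" "hd q = u" "last q = v"
    by (auto simp: is_path_iff_walk walk_def induced_path_def)
  then have "graph_dist V E u v \<le> enat (length q - 1)"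
    unfolding graph_dist_def by (intro INF_lower) simp
  also have "\<dots> \<le> enat (length p - 1)"
    using q(3) by (simp add: diff_le_mono)
  finally show ?thesis .
qed

lemma graph_dist_eq_enatE:
  assumes "graph_dist V E u v = enat n"
  obtains p where "walk E V u p v" "length p = Suc n"
proof -
  let ?P = "{p. is_path V E p \<and> hd p = u \<and> last p = v}"
  have "?P \<noteq> {}"
  proof
    assume "?P = {}"
    then have "graph_dist V E u v = \<infinity>"
      unfolding graph_dist_def by (simp only: image_empty) (simp add: top_enat_def)
    then show False using assms by simp
  qed
  then have "graph_dist V E u v \<in> (\<lambda>p. enat (length p - 1)) ` ?P"
    unfolding graph_dist_def
    by (metis (mono_tags, lifting) ex_in_conv image_is_empty wellorder_InfI)
  then obtain p where "p \<in> ?P" "length p - 1 = n"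
    using assms by auto
  then have "walk E V u p v" "length p = Suc n"
    by (auto simp: is_path_iff_walk walk_def Suc_diff_Suc)
  then show thesis using that by blast
qed

lemma graph_dist_eq_0_iff:
  assumes "simple_graph V E"
  shows "graph_dist V E u v = 0 \<longleftrightarrow> u = v \<and> v \<in> V"
proof
  assume "graph_dist V E u v = 0"
  then obtain p where "walk E V u p v" "length p = Suc 0"
    using graph_dist_eq_enatE by (metis zero_enat_def)
  then show "u = v \<and> v \<in> V"
    by (auto simp: walk_def length_Suc_conv)
next
  assume "u = v \<and> v \<in> V"
  then show "graph_dist V E u v = 0"
    using graph_dist_le_walk[OF assms, of u "[v]" v] by (simp add: walk_def flip: zero_enat_def)
qed

lemma graph_dist_edge_le:
  assumes "simple_graph V E" "{v, w} \<in> E"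
  shows "graph_dist V E u w \<le> eSuc (graph_dist V E u v)"
proof (cases "graph_dist V E u v")
  case (enat n)
  obtain p where p: "walk E V u p v" "length p = Suc n"
    using graph_dist_eq_enatE[OF enat] .
  then have "walk E V u (p @ [w]) w"
    using assms(2) simple_graph_edgeD(2)[OF assms] by (simp add: walk_def path_edges_append)
  from graph_dist_le_walk[OF assms(1) this] show ?thesis
    using p(2) enat by (simp add: eSuc_enat)
qed simp

lemma graph_dist_eq_SucE:
  assumes "simple_graph V E" "graph_dist V E u v = enat (Suc n)"
  obtains w where "{w, v} \<in> E" "graph_dist V E u w = enat n"
proof -
  obtain p where p: "walk E V u p v" "length p = Suc (Suc n)"
    using graph_dist_eq_enatE[OF assms(2)] .
  then obtain q w where q: "p = q @ w # [v]" "length q = n"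
    by (auto simp: length_Suc_conv_rev walk_def)
  then have w: "walk E V u (q @ [w]) w" "{w, v} \<in> E"
    using p(1) walk_split[of E V u q w "[v]" v] by (simp_all add: walk_def)
  have "graph_dist V E u w \<le> enat n"
    using graph_dist_le_walk[OF assms(1) w(1)] q(2) by simp
  moreover have "enat (Suc n) \<le> eSuc (graph_dist V E u w)"
    using graph_dist_edge_le[OF assms(1) w(2), of u] assms(2) by simp
  ultimately have "graph_dist V E u w = enat n"
    by (simp flip: eSuc_enat)
  then show thesis using that w(2) by blast
qed

lemma graph_dist_le_1_iff:
  assumes "simple_graph V E"
  shows "graph_dist V E u v \<le> enat 1 \<longleftrightarrow> u = v \<and> v \<in> V \<or> {u, v} \<in> E"
proof
  assume "graph_dist V E u v \<le> enat 1"
  then consider "graph_dist V E u v = 0" | "graph_dist V E u v = enat (Suc 0)"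
    by (cases "graph_dist V E u v") (auto simp: zero_enat_def le_Suc_eq)
  then show "u = v \<and> v \<in> V \<or> {u, v} \<in> E"
  proof cases
    case 1
    then show ?thesis using graph_dist_eq_0_iff[OF assms] by simp
  next
    case 2
    obtain w where "{w, v} \<in> E" "graph_dist V E u w = 0"
      using graph_dist_eq_SucE[OF assms 2] unfolding zero_enat_def .
    then show ?thesis
      using graph_dist_eq_0_iff[OF assms] by simp
  qed
next
  assume "u = v \<and> v \<in> V \<or> {u, v} \<in> E"
  then show "graph_dist V E u v \<le> enat 1"
  proof
    assume uv: "{u, v} \<in> E"
    then have "graph_dist V E u u = 0"
      using simple_graph_edgeD(1)[OF assms] graph_dist_eq_0_iff[OF assms] by simp
    then show ?thesis
      using graph_dist_edge_le[OF assms uv, of u] by (simp flip: eSuc_enat zero_enat_def)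
  qed (simp add: graph_dist_eq_0_iff[OF assms, THEN iffD2])
qed

lemma graph_dist_le_2_iff:
  assumes "simple_graph V E" "u \<noteq> v"
  shows "graph_dist V E u v \<le> enat 2 \<longleftrightarrow>
    {u, v} \<in> E \<or> (\<exists>m. {u, m} \<in> E \<and> {m, v} \<in> E)" (is "?le2 \<longleftrightarrow> ?near")
proof
  assume ?le2
  then consider "graph_dist V E u v \<le> enat 1" | "graph_dist V E u v = enat (Suc 1)"
    by (cases "graph_dist V E u v") (auto simp: numeral_2_eq_2 le_Suc_eq)
  then show ?near
  proof cases
    case 1
    then show ?thesis using graph_dist_le_1_iff[OF assms(1)] \<open>u \<noteq> v\<close> by simp
  next
    case 2
    obtain m where "{m, v} \<in> E" "graph_dist V E u m = enat 1"
      using graph_dist_eq_SucE[OF assms(1) 2] .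
    then show ?thesis
      using graph_dist_le_1_iff[OF assms(1), of u m] by auto
  qed
next
  assume ?near
  then obtain m where m: "graph_dist V E u m \<le> enat 1" "m = v \<or> {m, v} \<in> E"
    using graph_dist_le_1_iff[OF assms(1)] by metis
  have "graph_dist V E u v \<le> eSuc (graph_dist V E u m)"
    using m(2) graph_dist_edge_le[OF assms(1)] ile_eSuc by metis
  also have "\<dots> \<le> eSuc (enat 1)"
    using m(1) by simp
  finally show ?le2 by (simp add: eSuc_enat numeral_2_eq_2)
qed

lemma square_edges_iff:
  assumes "simple_graph V E"
  shows "{u, v} \<in> square_edges V E \<longleftrightarrow>
    u \<noteq> v \<and> ({u, v} \<in> E \<or> (\<exists>m. {u, m} \<in> E \<and> {m, v} \<in> E))"
    (is "_ \<longleftrightarrow> u \<noteq> v \<and> ?near u v")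
proof -
  have dist: "graph_dist V E x y \<in> {1, 2} \<longleftrightarrow> ?near x y" if "x \<noteq> y" for x y
  proof -
    have "graph_dist V E x y \<in> {1, 2} \<longleftrightarrow> graph_dist V E x y \<le> enat 2"
      using that graph_dist_eq_0_iff[OF assms, of x y]
      by (cases "graph_dist V E x y") (auto simp: one_enat_def zero_enat_def numeral_eq_enat)
    also have "\<dots> \<longleftrightarrow> ?near x y"
      using graph_dist_le_2_iff[OF assms that] .
    finally show ?thesis .
  qed
  have sym: "?near x y \<longleftrightarrow> ?near y x" for x y
    using insert_commute[of x y "{}"] insert_commute[of x _ "{}"] insert_commute[of _ y "{}"]
    by auto
  have "{u, v} \<in> square_edges V E \<longleftrightarrow>
      (\<exists>x y. {u, v} = {x, y} \<and> x \<in> V \<and> y \<in> V \<and> x \<noteq> y \<and> ?near x y)"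
    unfolding square_edges_def using dist by (simp cong: conj_cong)
  also have "\<dots> \<longleftrightarrow> u \<in> V \<and> v \<in> V \<and> u \<noteq> v \<and> ?near u v"
    unfolding doubleton_eq_iff using sym[of u v] by auto
  also have "\<dots> \<longleftrightarrow> u \<noteq> v \<and> ?near u v"
    using simple_graph_edgeD(1,2)[OF assms] by blast
  finally show ?thesis .
qed

definition linked :: "'a set set \<Rightarrow> 'a set \<Rightarrow> 'a \<Rightarrow> 'a \<Rightarrow> bool" where
  "linked E S x y \<longleftrightarrow> (\<exists>p. walk E S x p y)"

lemma linked_refl: "x \<in> S \<Longrightarrow> linked E S x x"
  unfolding linked_def by (rule exI[of _ "[x]"]) (simp add: walk_def)

lemma linked_edge: "{x, y} \<in> E \<Longrightarrow> x \<in> S \<Longrightarrow> y \<in> S \<Longrightarrow> linked E S x y"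
  unfolding linked_def by (rule exI[of _ "[x, y]"]) (simp add: walk_def)

lemma linked_sym: "linked E S x y \<Longrightarrow> linked E S y x"
  unfolding linked_def walk_def by (metis hd_rev last_rev path_edges_rev rev_is_Nil_conv set_rev)

lemma linked_mono: "linked E S x y \<Longrightarrow> S \<subseteq> T \<Longrightarrow> linked E T x y"
  unfolding linked_def walk_def by blast

lemma linked_mem: "linked E S x y \<Longrightarrow> x \<in> S \<and> y \<in> S"
  unfolding linked_def walk_def by auto

lemma linked_trans:
  assumes "linked E S x y" "linked E S y z"
  shows "linked E S x z"
proof -
  obtain p q where p: "walk E S x p y" and q: "walk E S y q z"
    using assms unfolding linked_def by blast
  obtain us ws where "p = us @ [y]" "q = y # ws"
    using p q by (metis append_butlast_last_id list.collapse walk_def)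
  then have "walk E S x (us @ y # ws) z"
    using p q walk_split by metis
  then show ?thesis unfolding linked_def by blast
qed

section \<open>Chordal graphs\<close>

lemma nonadjacent_linked_induced_path:
  assumes "simple_graph V E" "linked E S x y" "x \<noteq> y" "{x, y} \<notin> E"
  obtains p where "walk E S x (p @ [y]) y" "induced_path E (p @ [y])" "hd p = x" "2 \<le> length p"
proof -
  obtain q where q: "walk E S x q y" "induced_path E q"
    using assms(2) walk_imp_induced_path[OF assms(1)] unfolding linked_def by metis
  then obtain p where p: "q = p @ [y]"
    by (metis append_butlast_last_id walk_def)
  then have "p \<noteq> []" "hd p = x"
    using q(1) \<open>x \<noteq> y\<close> by (cases p; simp add: walk_def)+
  moreover have "p \<noteq> [x]"
  proof
    assume "p = [x]"
    then have "path_edges q = {{x, y}}"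
      using p by simp
    then show False
      using q(1) \<open>{x, y} \<notin> E\<close> by (simp add: walk_def)
  qed
  ultimately have "2 \<le> length p"
    by (cases p; cases "tl p") auto
  then show thesis
    using that q p \<open>hd p = x\<close> by blast
qed

lemma two_paths_cycle:
  assumes "walk E S x (p @ [y]) y" "walk E T y (q @ [x]) x" "S \<inter> T \<subseteq> {x, y}"
    and "distinct (p @ [y])" "distinct (q @ [x])" "2 \<le> length p" "2 \<le> length q"
  shows "is_cycle E (p @ q)"
    and "cycle_edges (p @ q) = path_edges (p @ [y]) \<union> path_edges (q @ [x])"
    and "set (p @ q) = set (p @ [y]) \<union> set (q @ [x])"
proof -
  have ne: "p \<noteq> []" "q \<noteq> []"
    using assms(6,7) by auto
  then have hd: "hd p = x" "hd q = y"
    using assms(1,2) by (simp_all add: walk_def)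
  show "set (p @ q) = set (p @ [y]) \<union> set (q @ [x])"
    using ne hd hd_in_set[of p] hd_in_set[of q] by auto
  show edges: "cycle_edges (p @ q) = path_edges (p @ [y]) \<union> path_edges (q @ [x])"
    using ne hd by (auto simp: cycle_edges_eq_path_edges path_edges_append)
  have "set p \<subseteq> S - {y}" "set q \<subseteq> T - {x}"
    using assms(1,2,4,5) by (auto simp: walk_def)
  then have "distinct (p @ q)"
    using assms(3-5) by auto
  then show "is_cycle E (p @ q)"
    using assms(1,2,6,7) edges by (simp add: is_cycle_def walk_def)
qed

text \<open>The core of Dirac's theorem that minimal separators of chordal graphs are cliques: shortest
  walks within \<open>S\<close> and \<open>T\<close> close up to a cycle that has no other chord.\<close>

lemma chordal_separated_adjacent:
  assumes "simple_graph V E" "chordal E" "x \<noteq> y"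
    and "linked E S x y" "linked E T x y" "S \<inter> T \<subseteq> {x, y}"
    and no_edge: "\<And>a b. a \<in> S - {x, y} \<Longrightarrow> b \<in> T - {x, y} \<Longrightarrow> {a, b} \<notin> E"
  shows "{x, y} \<in> E"
proof (rule ccontr)
  assume "{x, y} \<notin> E"
  obtain p where p: "walk E S x (p @ [y]) y" "induced_path E (p @ [y])" "hd p = x" "2 \<le> length p"
    using nonadjacent_linked_induced_path[OF assms(1,4,3) \<open>{x, y} \<notin> E\<close>] .
  have "y \<noteq> x" "{y, x} \<notin> E"
    using \<open>x \<noteq> y\<close> \<open>{x, y} \<notin> E\<close> by (simp_all add: insert_commute)
  then obtain q where q: "walk E T y (q @ [x]) x" "induced_path E (q @ [x])" "hd q = y"
      "2 \<le> length q"
    using nonadjacent_linked_induced_path[OF assms(1) linked_sym[OF assms(5)]] by metis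
  note cycle = two_paths_cycle[OF p(1) q(1) assms(6) induced_path_distinct[OF p(2)]
      induced_path_distinct[OF q(2)] p(4) q(4)]
  have "4 \<le> length (p @ q)"
    using p(4) q(4) by simp
  then obtain e where e: "e \<in> E" "e \<subseteq> set (p @ q)" "e \<notin> cycle_edges (p @ q)"
    using \<open>chordal E\<close> cycle(1) unfolding chordal_def by blast
  then have "\<not> e \<subseteq> set (p @ [y])" "\<not> e \<subseteq> set (q @ [x])"
    using induced_pathD[OF p(2)] induced_pathD[OF q(2)] cycle(2) by blast+
  then obtain a b where ab: "a \<in> e" "a \<notin> set (q @ [x])" "b \<in> e" "b \<notin> set (p @ [y])"
    by blast
  then have "a \<in> set (p @ [y])" "b \<in> set (q @ [x])"
    using e(2) cycle(3) by blast+
  moreover have "x \<in> set p"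
    using p(3,4) by (cases p) auto
  moreover have "y \<in> set q"
    using q(3,4) by (cases q) auto
  ultimately have "a \<in> S - {x, y}" "b \<in> T - {x, y}" "a \<noteq> b"
    using ab p(1) q(1) unfolding walk_def by auto
  moreover have "e = {a, b}"
    using assms(1) e(1) ab(1,3) \<open>a \<noteq> b\<close> by (auto simp: simple_graph_def card_2_iff)
  ultimately show False
    using no_edge e(1) by blast
qed

lemma chordal_unique_neighbour_adjacent:
  assumes "simple_graph V E" "chordal E" "{p, q} \<in> E" "{p, a} \<in> E" "{q, b} \<in> E"
    and "linked E T a b" "p \<notin> T" "q \<notin> T"
    and unique: "\<And>z. z \<in> T \<Longrightarrow> {q, z} \<in> E \<Longrightarrow> z = b"
  shows "{p, b} \<in> E"
proof (rule chordal_separated_adjacent[OF assms(1,2), where S = "{p, q, b}" and T = "insert p T"])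
  have ab: "a \<in> T" "b \<in> T"
    using linked_mem[OF assms(6)] by auto
  show "p \<noteq> b" using ab \<open>p \<notin> T\<close> by auto
  show "linked E {p, q, b} p b"
    using linked_trans[OF linked_edge[OF assms(3)] linked_edge[OF assms(5)]] by simp
  have "linked E (insert p T) p a"
    using linked_edge[OF assms(4)] ab by simp
  then show "linked E (insert p T) p b"
    using linked_trans linked_mono[OF assms(6)] by (metis subset_insertI)
  show "{p, q, b} \<inter> insert p T \<subseteq> {p, b}"
    using \<open>q \<notin> T\<close> by auto
  show "{s, t} \<notin> E" if "s \<in> {p, q, b} - {p, b}" "t \<in> insert p T - {p, b}" for s t
    using that unique by auto
qed

locale rooted_chordal_graph =
  fixes V :: "'a set" and E :: "'a set set" and r :: 'a
  assumes simple: "simple_graph V E" and chordal: "chordal E"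
begin

abbreviation depth :: "'a \<Rightarrow> enat" where
  "depth \<equiv> graph_dist V E r"

definition branch :: "nat \<Rightarrow> 'a \<Rightarrow> 'a set" where
  "branch k v = {u. linked E {z. enat k < depth z} v u}"

definition attachments :: "nat \<Rightarrow> 'a \<Rightarrow> 'a set" where
  "attachments k v = {q. depth q = enat k \<and> (\<exists>x\<in>branch k v. {q, x} \<in> E)}"

lemma depth_le_eSuc: "{u, v} \<in> E \<Longrightarrow> depth u \<le> eSuc (depth v)"
  by (rule graph_dist_edge_le[OF simple]) (simp add: insert_commute)

lemma depth_finite_edge:
  assumes "{u, v} \<in> E" "depth u \<noteq> \<infinity>"
  shows "depth v \<noteq> \<infinity>"
  using graph_dist_edge_le[OF simple assms(1), of r] assms(2)
  by (cases "depth v") (auto simp: eSuc_enat)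

lemma branch_self: "enat k < depth v \<Longrightarrow> v \<in> branch k v"
  by (simp add: branch_def linked_refl)

lemma depth_branch: "u \<in> branch k v \<Longrightarrow> enat k < depth u"
  unfolding branch_def using linked_mem by fastforce

lemma linked_root: "depth x = enat k \<Longrightarrow> linked E (insert x {z. depth z < enat k}) r x"
proof (induction k arbitrary: x)
  case 0
  then show ?case
    using graph_dist_eq_0_iff[OF simple, of r x] by (auto simp: zero_enat_def intro: linked_refl)
next
  case (Suc k)
  obtain w where w: "{w, x} \<in> E" "depth w = enat k"
    using graph_dist_eq_SucE[OF simple Suc.prems] .
  let ?S = "insert x {z. depth z < enat (Suc k)}"
  have "insert w {z. depth z < enat k} \<subseteq> ?S"
    using w(2) by (auto intro: less_trans[where y = "enat k"])
  then have "linked E ?S r w"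
    using linked_mono[OF Suc.IH[OF w(2)]] by blast
  moreover have "linked E ?S w x"
    using w by (intro linked_edge) auto
  ultimately show ?case by (rule linked_trans)
qed

lemma linked_via_root:
  assumes "depth x \<noteq> \<infinity>" "insert x {z. depth z < depth x} \<subseteq> S"
    and "depth y \<noteq> \<infinity>" "insert y {z. depth z < depth y} \<subseteq> S"
  shows "linked E S x y"
proof -
  have "linked E S r x"
    using linked_root assms(1,2) linked_mono by (metis not_infinity_eq)
  moreover have "linked E S r y"
    using linked_root assms(3,4) linked_mono by (metis not_infinity_eq)
  ultimately show ?thesis
    using linked_sym linked_trans by metis
qed

lemma branch_linked:
  assumes "x \<in> branch k v" "y \<in> branch k v"
  shows "linked E {z. enat k < depth z} x y"
  using assms linked_sym linked_trans unfolding branch_def by (metis mem_Collect_eq)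

lemma attachments_clique:
  assumes "p \<in> attachments k v" "q \<in> attachments k v" "p \<noteq> q"
  shows "{p, q} \<in> E"
proof (rule chordal_separated_adjacent[OF simple chordal \<open>p \<noteq> q\<close>])
  let ?S = "{p, q} \<union> {z. depth z < enat k}" and ?T = "{p, q} \<union> {z. enat k < depth z}"
  obtain a b where ab: "a \<in> branch k v" "b \<in> branch k v" "{p, a} \<in> E" "{b, q} \<in> E"
    using assms by (auto simp: attachments_def insert_commute)
  show "linked E ?S p q"
    using assms(1,2) by (intro linked_via_root) (auto simp: attachments_def)
  have "linked E ?T a b"
    using linked_mono[OF branch_linked[OF ab(1,2)]] by blast
  moreover have "linked E ?T p a" "linked E ?T b q"
    using ab depth_branch by (auto intro!: linked_edge)
  ultimately show "linked E ?T p q"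
    by (blast intro: linked_trans)
  show "?S \<inter> ?T \<subseteq> {p, q}"
    by auto
  show "{x, y} \<notin> E" if "x \<in> ?S - {p, q}" "y \<in> ?T - {p, q}" for x y
  proof
    assume "{x, y} \<in> E"
    then have "depth y \<le> eSuc (depth x)"
      by (rule graph_dist_edge_le[OF simple])
    also have "\<dots> \<le> enat k"
      using that(1) by (auto intro: ileI1)
    also have "\<dots> < depth y"
      using that(2) by blast
    finally show False by simp
  qed
qed

lemma depth_SucE:
  assumes "depth v = enat (Suc n)"
  obtains w where "{v, w} \<in> E" "depth w = enat n"
  using graph_dist_eq_SucE[OF simple assms] by (metis insert_commute)

lemma attachment_lower_neighbourE:
  assumes "p \<in> attachments k v" "q \<in> attachments k v" "p \<noteq> q"
  obtains g where "{q, g} \<in> E" "depth g < enat k"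
proof -
  have depth: "depth p = enat k" "depth q = enat k"
    using assms(1,2) by (simp_all add: attachments_def)
  then have "k \<noteq> 0"
    using assms(3) graph_dist_eq_0_iff[OF simple, of r] by (metis zero_enat_def)
  then obtain n where "k = Suc n"
    using not0_implies_Suc by blast
  then show thesis
    using depth_SucE depth(2) that by (metis enat_ord_simps(2) lessI)
qed

lemma attachment_neighboursE:
  assumes "finite V" "vdegree E q \<le> 3" "p \<in> attachments k v" "q \<in> attachments k v" "p \<noteq> q"
  obtains g b where "neighbours E q = {p, g, b}" "depth g < enat k" "b \<in> branch k v"
proof -
  obtain b where b: "b \<in> branch k v" "{q, b} \<in> E"
    using assms(4) by (auto simp: attachments_def)
  obtain g where g: "{q, g} \<in> E" "depth g < enat k"
    using attachment_lower_neighbourE[OF assms(3-5)] .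
  have "distinct [p, g, b]"
    using assms(3) g(2) depth_branch[OF b(1)] by (auto simp: attachments_def)
  moreover have "{p, g, b} \<subseteq> neighbours E q"
    using attachments_clique[OF assms(4,3)] assms(5) g(1) b(2) by (auto simp: neighbours_def)
  moreover have "finite (neighbours E q)"
    using finite_neighbours[OF assms(1) simple] .
  ultimately have "{p, g, b} = neighbours E q"
    using assms(2) by (intro card_seteq) (simp_all add: vdegree_eq_card_neighbours)
  then show thesis
    using that g(2) b(1) by blast
qed

lemma attachments_neighbours_subset:
  assumes "finite V" "vdegree E q \<le> 3" "p \<in> attachments k v" "q \<in> attachments k v"
  shows "neighbours E q \<subseteq> insert p (neighbours E p)"
proof (cases "p = q")
  case False
  obtain g b where nbrs: "neighbours E q = {p, g, b}" and g: "depth g < enat k"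
    and b: "b \<in> branch k v"
    using attachment_neighboursE[OF assms False] .
  then have unique: "z \<in> {p, g, b}" if "{q, z} \<in> E" for z
    using that unfolding neighbours_def by blast
  have q: "{q, g} \<in> E" "{q, b} \<in> E"
    using nbrs unfolding neighbours_def by blast+
  have pq: "{p, q} \<in> E"
    using attachments_clique[OF assms(3,4) False] .
  have depth: "depth p = enat k" "depth q = enat k"
    using assms(3,4) by (simp_all add: attachments_def)
  obtain a where a: "a \<in> branch k v" "{p, a} \<in> E"
    using assms(3) by (auto simp: attachments_def)
  obtain h where h: "{p, h} \<in> E" "depth h < enat k"
    using attachment_lower_neighbourE[OF assms(4,3)] False by blast
  have "{p, b} \<in> E"
  proof (rule chordal_unique_neighbour_adjacent[OF simple chordal pq a(2) q(2)])
    show "linked E {z. enat k < depth z} a b"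
      using branch_linked[OF a(1) b] .
    show "z = b" if "z \<in> {z. enat k < depth z}" "{q, z} \<in> E" for z
      using unique[OF that(2)] that(1) depth(1) g by auto
  qed (use depth in simp_all)
  moreover have "{p, g} \<in> E"
  proof (rule chordal_unique_neighbour_adjacent[OF simple chordal pq h(1) q(1)])
    show "linked E {z. depth z < enat k} h g"
      using h(2) g by (intro linked_via_root) (auto intro: less_trans dest: enat_iless)
    show "z = g" if "z \<in> {z. depth z < enat k}" "{q, z} \<in> E" for z
      using unique[OF that(2)] that(1) depth_branch[OF b] depth(1) by auto
  qed (use depth in simp_all)
  ultimately show ?thesis
    unfolding nbrs by (simp add: mem_neighbours_iff insert_commute)
qed blast

lemma branch_neighbour:
  assumes "x \<in> branch k v" "{x, y} \<in> E"
  shows "y \<in> branch k v \<or> y \<in> attachments k v"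
proof -
  have "enat (Suc k) \<le> depth x"
    using depth_branch[OF assms(1)] by (simp add: ileI1 flip: eSuc_enat)
  also have "\<dots> \<le> eSuc (depth y)"
    using depth_le_eSuc[OF assms(2)] .
  finally consider "depth y = enat k" | "enat k < depth y"
    by (auto simp: eSuc_enat[symmetric] le_less)
  then show ?thesis
  proof cases
    case 1
    then show ?thesis
      using assms by (auto simp: attachments_def insert_commute)
  next
    case 2
    then have "linked E {z. enat k < depth z} x y"
      using assms depth_branch by (auto intro: linked_edge)
    then show ?thesis
      using assms(1) by (auto simp: branch_def intro: linked_trans)
  qed
qed

lemma square_neighbour_attached:
  assumes "depth v = enat (Suc k)" "{v, u} \<in> square_edges V E" "depth u \<le> depth v"
  obtains q where "q \<in> attachments k v" "u \<in> insert q (neighbours E q)"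
proof -
  have v: "v \<in> branch k v"
    using assms(1) by (intro branch_self) simp
  have "u \<in> branch k v \<or> u \<in> attachments k v \<or> (\<exists>q\<in>attachments k v. {q, u} \<in> E)"
    using assms(2) branch_neighbour v unfolding square_edges_iff[OF simple] by blast
  moreover have "\<exists>q\<in>attachments k v. {q, u} \<in> E" if "u \<in> branch k v"
  proof -
    have "depth u = enat (Suc k)"
      using depth_branch[OF that] assms(1,3) by (simp add: antisym ileI1 flip: eSuc_enat)
    then obtain q where "{u, q} \<in> E" "depth q = enat k"
      using depth_SucE by blast
    then show ?thesis
      using that by (auto simp: attachments_def insert_commute)
  qed
  ultimately show thesis
    using that by (auto simp: neighbours_def)
qed

lemma deepest_square_neighbours_subset:
  assumes "finite V" and subcubic: "\<And>z. vdegree E z \<le> 3"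
    and "depth v = enat (Suc k)" "{p, v} \<in> E" "depth p = enat k"
  shows "{u. {v, u} \<in> square_edges V E \<and> depth u \<le> depth v} \<subseteq> insert p (neighbours E p - {v})"
proof
  fix u
  assume "u \<in> {u. {v, u} \<in> square_edges V E \<and> depth u \<le> depth v}"
  then obtain q where q: "q \<in> attachments k v" "u \<in> insert q (neighbours E q)" and "u \<noteq> v"
    using square_neighbour_attached[OF assms(3)] square_edges_iff[OF simple] by blast
  have p: "p \<in> attachments k v"
    using assms(3-5) branch_self[of k v] unfolding attachments_def by fastforce
  then have "q \<in> insert p (neighbours E p)"
    using attachments_clique[OF _ q(1)] by (auto simp: neighbours_def)
  then have "u \<in> insert p (neighbours E p)"
    using q attachments_neighbours_subset[OF assms(1) subcubic p q(1)] by blast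
  then show "u \<in> insert p (neighbours E p - {v})"
    using \<open>u \<noteq> v\<close> by blast
qed

lemma deepest_square_degree_le:
  assumes "finite V" and degree: "\<And>z. vdegree E z \<le> \<Delta>" and "\<Delta> \<le> 3"
    and "depth v \<noteq> \<infinity>" and deepest: "\<And>u. u \<in> W \<Longrightarrow> depth u \<noteq> \<infinity> \<Longrightarrow> depth u \<le> depth v"
  shows "card (W \<inter> neighbours (square_edges V E) v) \<le> \<Delta>"
proof -
  let ?N = "W \<inter> neighbours (square_edges V E) v"
  have "depth u \<noteq> \<infinity>" if "{v, u} \<in> square_edges V E" for u
    using that \<open>depth v \<noteq> \<infinity>\<close> depth_finite_edge unfolding square_edges_iff[OF simple] by metis
  then have N: "{v, u} \<in> square_edges V E" "depth u \<le> depth v" if "u \<in> ?N" for u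
    using that deepest by (simp_all add: neighbours_def)
  obtain j where j: "depth v = enat j"
    using \<open>depth v \<noteq> \<infinity>\<close> by blast
  show ?thesis
  proof (cases j)
    case 0
    have "u = v" if "depth u \<le> depth v" for u
      using that j 0 graph_dist_eq_0_iff[OF simple] by (metis le_zero_eq zero_enat_def)
    then have "?N = {}"
      using N square_edges_iff[OF simple] by blast
    then show ?thesis by (metis card.empty le0)
  next
    case (Suc k)
    obtain p where p: "{p, v} \<in> E" "depth p = enat k"
      using graph_dist_eq_SucE[OF simple j[unfolded Suc]] .
    have fin: "finite (neighbours E p)"
      using finite_neighbours[OF \<open>finite V\<close> simple] .
    have "?N \<subseteq> insert p (neighbours E p - {v})"
      using N deepest_square_neighbours_subset[OF assms(1) le_trans[OF degree \<open>\<Delta> \<le> 3\<close>] _ p] j Suc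
      by blast
    then have "card ?N \<le> card (insert p (neighbours E p - {v}))"
      using fin by (intro card_mono) auto
    also have "\<dots> \<le> Suc (card (neighbours E p - {v}))"
      using fin by (simp add: card_insert_if)
    also have "\<dots> = vdegree E p"
      unfolding vdegree_eq_card_neighbours using p(1) fin
      by (intro card_Suc_Diff1) (auto simp: neighbours_def)
    finally show ?thesis using degree[of p] by simp
  qed
qed

end

section \<open>Clique number, chromatic number and inductiveness\<close>

lemma vdegree_induced_edges:
  assumes "v \<in> W"
  shows "vdegree (induced_edges F W) v = card (W \<inter> neighbours F v)"
  using assms unfolding vdegree_def induced_edges_def neighbours_def
  by (intro arg_cong[of _ _ card]) auto

lemma ex_vdegree_le_inductiveness:
  assumes "finite V" "W \<subseteq> V" "W \<noteq> {}"
  obtains v where "v \<in> W" "vdegree (induced_edges F W) v \<le> inductiveness V F"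
proof -
  have "finite W" using assms finite_subset by blast
  then have "min_degree W (induced_edges F W) \<in> vdegree (induced_edges F W) ` W"
    unfolding min_degree_def using \<open>W \<noteq> {}\<close> by (intro Min_in) auto
  moreover have "min_degree W (induced_edges F W) \<le> inductiveness V F"
    unfolding inductiveness_def using assms by (intro Max_ge) auto
  ultimately show thesis using that by auto
qed

lemma inductiveness_le:
  assumes "finite V" "V \<noteq> {}"
    and low: "\<And>W. W \<subseteq> V \<Longrightarrow> W \<noteq> {} \<Longrightarrow> \<exists>v\<in>W. vdegree (induced_edges F W) v \<le> d"
  shows "inductiveness V F \<le> d"
proof -
  have "min_degree W (induced_edges F W) \<le> d" if W: "W \<subseteq> V" "W \<noteq> {}" for W
  proof -
    obtain v where v: "v \<in> W" "vdegree (induced_edges F W) v \<le> d"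
      using low[OF W] by blast
    have "finite W" using W \<open>finite V\<close> finite_subset by blast
    then have "min_degree W (induced_edges F W) \<le> vdegree (induced_edges F W) v"
      unfolding min_degree_def using v(1) by (intro Min_le) auto
    then show ?thesis using v(2) by linarith
  qed
  then show ?thesis
    unfolding inductiveness_def using assms(1,2) by (intro Max.boundedI) auto
qed

lemma proper_coloring_extend:
  assumes "finite W" "{v, v} \<notin> F" "proper_coloring (W - {v}) F k c" "card (W \<inter> neighbours F v) < k"
  obtains c' where "proper_coloring W F k c'"
proof -
  let ?N = "W \<inter> neighbours F v"
  have "card (c ` ?N) < card {..<k}"
    using assms(1,4) card_image_le[of ?N c] by simp
  then obtain a where a: "a < k" "a \<notin> c ` ?N"
    using assms(1) card_mono[of "c ` ?N" "{..<k}"] by fastforce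
  have "proper_coloring W F k (c(v := a))"
    unfolding proper_coloring_def
  proof (intro conjI ballI impI)
    show "(c(v := a)) ` W \<subseteq> {..<k}"
      using assms(3) a unfolding proper_coloring_def by auto
    fix x y
    assume "x \<in> W" "y \<in> W" "{x, y} \<in> F"
    moreover from this have "\<not> (x = v \<and> y = v)" "{y, x} \<in> F"
      using assms(2) by (auto simp: insert_commute)
    ultimately show "(c(v := a)) x \<noteq> (c(v := a)) y"
      using assms(3) a unfolding proper_coloring_def neighbours_def by auto
  qed
  then show thesis by (rule that)
qed

lemma ex_proper_coloring_Suc_inductiveness:
  assumes "finite V" and loop: "\<And>v. {v, v} \<notin> F"
  obtains c where "proper_coloring V F (Suc (inductiveness V F)) c"
proof -
  have "\<exists>c. proper_coloring W F (Suc (inductiveness V F)) c" if "W \<subseteq> V" for W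
    using finite_subset[OF that \<open>finite V\<close>] that
  proof (induction W rule: finite_psubset_induct)
    case (psubset W)
    show ?case
    proof (cases "W = {}")
      case True
      then show ?thesis by (simp add: proper_coloring_def)
    next
      case False
      obtain v where v: "v \<in> W" "vdegree (induced_edges F W) v \<le> inductiveness V F"
        using ex_vdegree_le_inductiveness[OF assms(1) psubset.prems False] .
      then have "W - {v} \<subset> W" "W - {v} \<subseteq> V"
        using psubset.prems by auto
      then obtain c where "proper_coloring (W - {v}) F (Suc (inductiveness V F)) c"
        using psubset.IH by blast
      then show ?thesis
        using proper_coloring_extend[OF psubset.hyps loop] v
        by (metis vdegree_induced_edges le_imp_less_Suc)
    qed
  qed
  then show thesis using that by blast
qed

lemma chromatic_number_le_Suc_inductiveness:
  assumes "finite V" "\<And>v. {v, v} \<notin> F"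
  shows "chromatic_number V F \<le> Suc (inductiveness V F)"
  unfolding chromatic_number_def
  using ex_proper_coloring_Suc_inductiveness[OF assms] by (metis Least_le)

lemma clique_card_le_colors:
  assumes "is_clique V F K" "proper_coloring V F k c"
  shows "card K \<le> k"
proof -
  have "inj_on c K" "c ` K \<subseteq> {..<k}"
    using assms unfolding is_clique_def proper_coloring_def inj_on_def by blast+
  then show ?thesis
    by (metis card_inj_on_le card_lessThan finite_lessThan)
qed

lemma finite_clique_cards:
  assumes "finite V"
  shows "finite {card K | K. is_clique V F K}"
  by (rule finite_subset[of _ "card ` Pow V"]) (use assms in \<open>auto simp: is_clique_def\<close>)

lemma card_le_clique_number:
  assumes "finite V" "is_clique V F K"
  shows "card K \<le> clique_number V F"
  unfolding clique_number_def using assms finite_clique_cards by (intro Max_ge) auto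

lemma clique_number_le_chromatic_number:
  assumes "finite V" "\<And>v. {v, v} \<notin> F"
  shows "clique_number V F \<le> chromatic_number V F"
proof -
  obtain c where "proper_coloring V F (Suc (inductiveness V F)) c"
    using ex_proper_coloring_Suc_inductiveness[OF assms] .
  then have "\<exists>c. proper_coloring V F (chromatic_number V F) c"
    unfolding chromatic_number_def by (intro LeastI_ex[of "\<lambda>k. \<exists>c. proper_coloring V F k c"]) blast
  then have "card K \<le> chromatic_number V F" if "is_clique V F K" for K
    using clique_card_le_colors[OF that] by blast
  moreover have "is_clique V F {}"
    by (simp add: is_clique_def)
  ultimately show ?thesis
    unfolding clique_number_def using finite_clique_cards[OF assms(1)]
    by (intro Max.boundedI) auto
qed

section \<open>Squares of subcubic chordal graphs\<close>

lemma closed_neighbourhood_clique_square: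
  assumes "simple_graph V E" "v \<in> V"
  shows "is_clique V (square_edges V E) (insert v (neighbours E v))"
  using assms(2) neighbours_subset[OF assms(1), of v]
  unfolding is_clique_def square_edges_iff[OF assms(1)]
  by (auto simp: mem_neighbours_iff insert_commute)

lemma subcubic_chordal_square_degenerate:
  assumes "finite V" "simple_graph V E" "chordal E" "W \<subseteq> V" "W \<noteq> {}"
    and degree: "\<And>z. vdegree E z \<le> \<Delta>" and "\<Delta> \<le> 3"
  shows "\<exists>v\<in>W. vdegree (induced_edges (square_edges V E) W) v \<le> \<Delta>"
proof -
  obtain r where r: "r \<in> W" using assms by blast
  interpret rooted_chordal_graph V E r
    by unfold_locales fact+
  let ?W = "{u \<in> W. depth u \<noteq> \<infinity>}"
  have "depth r = 0"
    using graph_dist_eq_0_iff[OF simple] r assms(4) by blast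
  then have "r \<in> ?W" using r by (simp add: zero_enat_def)
  moreover have "finite ?W"
    using finite_subset[OF assms(4,1)] by simp
  ultimately have "Max (depth ` ?W) \<in> depth ` ?W"
    by (intro Max_in) auto
  then obtain v where v: "v \<in> ?W" "depth v = Max (depth ` ?W)"
    by auto
  then have "depth u \<le> depth v" if "u \<in> W" "depth u \<noteq> \<infinity>" for u
    using that \<open>finite ?W\<close> by simp
  then have "card (W \<inter> neighbours (square_edges V E) v) \<le> \<Delta>"
    using v(1) by (intro deepest_square_degree_le[OF assms(1) degree \<open>\<Delta> \<le> 3\<close>]) auto
  then show ?thesis
    using v(1) by (auto simp: vdegree_induced_edges)
qed

theorem theorem4p3:
  fixes V :: "'a set" and E :: "'a set set" and \<Delta> :: nat
  assumes "finite V"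
    and "simple_graph V E"
    and "chordal E"
    and "outerplanar V E"
    and "max_degree V E = \<Delta>"
    and "\<Delta> \<in> {2, 3}"
  shows "clique_number V (square_edges V E) = chromatic_number V (square_edges V E) \<and>
         chromatic_number V (square_edges V E) = inductiveness V (square_edges V E) + 1 \<and>
         inductiveness V (square_edges V E) + 1 = \<Delta> + 1"
proof -
  let ?F = "square_edges V E"
  have "V \<noteq> {}"
    using assms(5,6) by (auto simp: max_degree_def)
  then obtain v where v: "v \<in> V" "vdegree E v = \<Delta>"
    using ex_vdegree_eq_max_degree[OF assms(1)] assms(5) by metis
  have loop: "{u, u} \<notin> ?F" for u
    using square_edges_iff[OF assms(2), of u u] by simp
  have "Suc \<Delta> \<le> clique_number V ?F"
    using card_le_clique_number[OF assms(1) closed_neighbourhood_clique_square[OF assms(2) v(1)]]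
      card_closed_neighbourhood[OF assms(1,2)] v(2) by simp
  moreover have "clique_number V ?F \<le> chromatic_number V ?F"
    using clique_number_le_chromatic_number[OF assms(1)] loop by blast
  moreover have "chromatic_number V ?F \<le> Suc (inductiveness V ?F)"
    using chromatic_number_le_Suc_inductiveness[OF assms(1)] loop by blast
  moreover have "inductiveness V ?F \<le> \<Delta>"
    using vdegree_le_max_degree[OF assms(1,2)] assms(5,6)
    by (intro inductiveness_le[OF assms(1) \<open>V \<noteq> {}\<close>]
        subcubic_chordal_square_degenerate[OF assms(1-3)]) auto
  ultimately show ?thesis by simp
qed

end
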